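(* For any graph $G$ of order $n$ and size $m$, $$\chi_{\times 2}(G)\ \ge\ \frac12\left(1+\max\left\{\frac{2m}{n},\ \sqrt{1+\frac{4m-2n}{L_2(G)}}\right\}\right),$$ with equality if and only if $G\in\Lambda$, where $\Lambda$ is the family of graphs described in the context.
   Context: All graphs are finite and simple. The order of $G$ is $n=|V(G)|$ and the size is $m=|E(G)|$. $N[v]=N(v)\cup\{v\}$ is the closed neighborhood of $v$. A set $B\subseteq V(G)$ is a $2$-limited packing ($2$LP set) in $G$ if $|B\cap N[v]|\le 2$ for each vertex $v$ of $G$. $L_2(G)$ is the maximum cardinality of a $2$LP set in $G$. A $2$LP partition of $G$ is a partition of $V(G)$ into $2$LP sets, and $\chi_{\times2}(G)$ is the minimum cardinality taken over all $2$LP partitions of $G$. The family $\Lambda$: let $H$ be an $r$-partite graph with partite sets $V_1,\dots,V_r$ such that $|V_1|,\dots,|V_r|$ are all even and the induced subgraph $H[V_i\cup V_j]$ is a $2$-regular graph for each $1\le i\ne j\le r$. Let $G$ be obtained from $H$ by constructing a perfect matching using the vertices of $V_i$ for each $1\le i\le r$ (that is, adding the edges of a perfect matching on $V_i$). $\Lambda$ is the family of all graphs $G$ obtained in this way. *)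

theory Defs
  imports Complex_Main "HOL-Library.Disjoint_Sets" "HOL-Library.Ramsey"
begin

text \<open>
  A graph is given by its vertex set \<open>V\<close> and its edge set \<open>E\<close>, whose elements are
  two-element subsets of \<open>V\<close>; in particular there are no loops and no multiple edges.
\<close>

definition simple_graph :: "'a set \<Rightarrow> 'a set set \<Rightarrow> bool" where
  "simple_graph V E \<longleftrightarrow> finite V \<and> E \<subseteq> [V]\<^bsup>2\<^esup>"

definition neighborhood :: "'a set set \<Rightarrow> 'a \<Rightarrow> 'a set" where
  "neighborhood E v = {u. {v, u} \<in> E}"

definition closed_neighborhood :: "'a set set \<Rightarrow> 'a \<Rightarrow> 'a set" where
  "closed_neighborhood E v = neighborhood E v \<union> {v}"

definition induced_edges :: "'a set set \<Rightarrow> 'a set \<Rightarrow> 'a set set" where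
  "induced_edges E W = {e \<in> E. e \<subseteq> W}"

definition regular_graph :: "nat \<Rightarrow> 'a set \<Rightarrow> 'a set set \<Rightarrow> bool" where
  "regular_graph k V E \<longleftrightarrow> (\<forall>v\<in>V. card (neighborhood E v) = k)"

definition two_limited_packing :: "'a set \<Rightarrow> 'a set set \<Rightarrow> 'a set \<Rightarrow> bool" where
  "two_limited_packing V E B \<longleftrightarrow> B \<subseteq> V \<and> (\<forall>v\<in>V. card (B \<inter> closed_neighborhood E v) \<le> 2)"

definition two_limited_packing_number :: "'a set \<Rightarrow> 'a set set \<Rightarrow> nat" where
  "two_limited_packing_number V E = Max (card ` {B. two_limited_packing V E B})"

definition two_LP_partition :: "'a set \<Rightarrow> 'a set set \<Rightarrow> 'a set set \<Rightarrow> bool" where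
  "two_LP_partition V E P \<longleftrightarrow> partition_on V P \<and> (\<forall>B\<in>P. two_limited_packing V E B)"

definition two_LP_partition_number :: "'a set \<Rightarrow> 'a set set \<Rightarrow> nat" where
  "two_LP_partition_number V E = Min (card ` {P. two_LP_partition V E P})"

definition r_partite :: "nat \<Rightarrow> (nat \<Rightarrow> 'a set) \<Rightarrow> 'a set \<Rightarrow> 'a set set \<Rightarrow> bool" where
  "r_partite r W V E \<longleftrightarrow>
     simple_graph V E \<and> (\<Union>i\<in>{1..r}. W i) = V \<and> disjoint_family_on W {1..r} \<and>
     (\<forall>i\<in>{1..r}. W i \<noteq> {} \<and> indep (W i) E)"

text \<open>
  The pairs of a perfect matching on \<open>W\<close> are arbitrary two-element subsets of \<open>W\<close>: they are
  not required to be edges of a graph given beforehand.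
\<close>

definition perfect_matching_on :: "'a set \<Rightarrow> 'a set set \<Rightarrow> bool" where
  "perfect_matching_on W M \<longleftrightarrow> M \<subseteq> [W]\<^bsup>2\<^esup> \<and> (\<forall>w\<in>W. \<exists>!e. e \<in> M \<and> w \<in> e)"

text \<open>
  In the definition below, \<open>F\<close> is the edge set of the multipartite graph \<open>H\<close> on \<open>V\<close> with
  partite sets \<open>W 1, \<dots>, W r\<close>, and \<open>M i\<close> is the perfect matching added on \<open>W i\<close>. The case
  \<open>r = 1\<close> is included: there \<open>H\<close> is edgeless and the graph obtained is itself a perfect matching.
\<close>

definition Lambda :: "('a set \<times> 'a set set) set" where
  "Lambda = {(V, E). \<exists>r W F M. r \<ge> 1 \<and> r_partite r W V F \<and>
     (\<forall>i\<in>{1..r}. even (card (W i))) \<and>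
     (\<forall>i\<in>{1..r}. \<forall>j\<in>{1..r}. i \<noteq> j \<longrightarrow>
        regular_graph 2 (W i \<union> W j) (induced_edges F (W i \<union> W j))) \<and>
     (\<forall>i\<in>{1..r}. perfect_matching_on (W i) (M i)) \<and>
     E = F \<union> (\<Union>i\<in>{1..r}. M i)}"

end

theory Submission
  imports Defs
begin

text \<open>
  Let \<open>P\<close> be a partition of \<open>V\<close> into \<open>k\<close> 2-limited packings. The parts split the closed
  neighborhood of each vertex \<open>v\<close> into \<open>k\<close> pieces of at most two vertices each, so
  \<open>deg v + 1 \<le> 2 k\<close>. Summing over all vertices gives \<open>2 m + n \<le> 2 k n\<close>
  (\<open>size_le_of_two_LP_partition\<close>), which for \<open>k = \<chi>\<close>, the 2LP partition number, is the
  bound through the average degree.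

  The bound through \<open>L\<close>, the 2-limited packing number, follows from this inequality. Since every part has at most
  \<open>L\<close> vertices, \<open>n \<le> k L\<close>, and therefore
  \<open>4 m - 2 n \<le> 4 (k - 1) n \<le> 4 k (k - 1) L = ((2 k - 1)\<^sup>2 - 1) L\<close>.
  If the two ends of this chain agree then so do the first two terms, which says
  \<open>2 m + n = 2 k n\<close>. Hence \<open>k\<close> equals the claimed lower bound if and only if \<open>2 m + n = 2 k n\<close>
  (\<open>max_bound_of_size_and_order_bounds\<close>).

  Equality \<open>2 m + n = 2 k n\<close> for the sum over all vertices forces equality in each term: every
  part meets every closed neighborhood in exactly two vertices. Such a partition, called exact
  below, is just another description of the family \<open>Lambda\<close>. A vertex has exactly one neighbor in
  its own part, so each part carries a perfect matching, and exactly two neighbors in every other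
  part, so any two parts induce a 2-regular graph once the matchings are removed; the converse
  reads the same counts backwards (\<open>exact_partition_imp_Lambda\<close>,
  \<open>Lambda_imp_exact_partition\<close>). Finally, an exact partition \<open>Q\<close> satisfies
  \<open>2 m + n = 2 |Q| n\<close>, so \<open>2 m + n \<le> 2 \<chi> n\<close> makes it a smallest 2LP partition
  and equality holds for \<open>\<chi>\<close>.
\<close>

section \<open>Degrees and closed neighborhoods\<close>

lemma in_neighborhood_iff: "u \<in> neighborhood E v \<longleftrightarrow> {v, u} \<in> E"
  by (simp add: neighborhood_def)

lemma simple_graph_edgeD:
  assumes "simple_graph V E" "{v, u} \<in> E"
  shows "v \<in> V" "u \<in> V" "v \<noteq> u"
proof -
  have "{v, u} \<in> [V]\<^bsup>2\<^esup>" using assms unfolding simple_graph_def by blast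
  then show "v \<in> V" "u \<in> V" "v \<noteq> u" by auto
qed

lemma neighborhood_subset:
  "simple_graph V E \<Longrightarrow> neighborhood E v \<subseteq> V - {v}"
  using simple_graph_edgeD(2,3)[of V E v] by (force simp: in_neighborhood_iff)

lemma finite_neighborhood:
  "simple_graph V E \<Longrightarrow> finite (neighborhood E v)"
  by (meson finite_Diff finite_subset neighborhood_subset simple_graph_def)

lemma finite_edges: "simple_graph V E \<Longrightarrow> finite E"
  by (meson finite_imp_finite_nsets finite_subset simple_graph_def)

lemma closed_neighborhood_subset:
  "simple_graph V E \<Longrightarrow> v \<in> V \<Longrightarrow> closed_neighborhood E v \<subseteq> V"
  using neighborhood_subset[of V E v] by (auto simp: closed_neighborhood_def)

lemma card_closed_neighborhood:
  assumes "simple_graph V E"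
  shows "card (closed_neighborhood E v) = card (neighborhood E v) + 1"
  using neighborhood_subset[OF assms, of v] finite_neighborhood[OF assms, of v]
  by (auto simp: closed_neighborhood_def card_insert_if)

lemma card_neighborhood_eq_incident_edges:
  assumes "simple_graph V E"
  shows "card (neighborhood E v) = card {e \<in> E. v \<in> e}"
proof -
  have "bij_betw (\<lambda>u. {v, u}) (neighborhood E v) {e \<in> E. v \<in> e}"
    unfolding bij_betw_def
  proof
    show "inj_on (\<lambda>u. {v, u}) (neighborhood E v)"
      by (auto simp: inj_on_def doubleton_eq_iff)
    show "(\<lambda>u. {v, u}) ` neighborhood E v = {e \<in> E. v \<in> e}"
    proof
      show "{e \<in> E. v \<in> e} \<subseteq> (\<lambda>u. {v, u}) ` neighborhood E v"
      proof
        fix e assume e: "e \<in> {e \<in> E. v \<in> e}"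
        then have "card e = 2"
          using assms by (auto simp: simple_graph_def nsets_def)
        with e obtain u where "e = {v, u}"
          by (auto simp: card_2_iff)
        with e show "e \<in> (\<lambda>u. {v, u}) ` neighborhood E v"
          by (auto simp: in_neighborhood_iff)
      qed
    qed (auto simp: in_neighborhood_iff)
  qed
  then show ?thesis
    by (rule bij_betw_same_card)
qed

text \<open>Both sides count the incident pairs of a vertex and an edge.\<close>

lemma handshake:
  assumes "simple_graph V E"
  shows "(\<Sum>v\<in>V. card (neighborhood E v)) = 2 * card E"
proof -
  have "(\<Sum>v\<in>V. card {e \<in> E. v \<in> e}) = 2 * card E"
  proof (rule sum_multicount)
    show "finite V" using assms by (simp add: simple_graph_def)
    show "finite E" by (rule finite_edges[OF assms])
    show "\<forall>e\<in>E. card {v \<in> V. v \<in> e} = 2"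
    proof
      fix e assume "e \<in> E"
      then have "e \<subseteq> V" "card e = 2"
        using assms by (auto simp: simple_graph_def nsets_def)
      moreover from this(1) have "{v \<in> V. v \<in> e} = e" by blast
      ultimately show "card {v \<in> V. v \<in> e} = 2" by simp
    qed
  qed
  then show ?thesis
    by (simp add: card_neighborhood_eq_incident_edges[OF assms])
qed

text \<open>
  This identity yields both the lower bound and its equality case: an upper bound on each
  summand bounds the degree, and the bound on the degree is tight exactly when every summand is
  maximal.
\<close>

lemma degree_via_partition:
  assumes G: "simple_graph V E" and P: "partition_on V P" and v: "v \<in> V"
  shows "card (neighborhood E v) + 1 = (\<Sum>B\<in>P. card (B \<inter> closed_neighborhood E v))"
proof -
  let ?N = "closed_neighborhood E v"
  have fV: "finite V" using G by (simp add: simple_graph_def)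
  have fP: "finite P" by (rule finite_elements[OF fV P])
  have "?N = (\<Union>B\<in>P. B \<inter> ?N)"
    using partition_onD1[OF P] closed_neighborhood_subset[OF G v] by blast
  also have "card \<dots> = (\<Sum>B\<in>P. card (B \<inter> ?N))"
  proof (rule card_UN_disjoint[OF fP])
    show "\<forall>B\<in>P. finite (B \<inter> ?N)"
      using finite_subset[OF closed_neighborhood_subset[OF G v] fV] by blast
    show "\<forall>A\<in>P. \<forall>B\<in>P. A \<noteq> B \<longrightarrow> (A \<inter> ?N) \<inter> (B \<inter> ?N) = {}"
      using partition_onD2[OF P] by (auto simp: disjoint_def)
  qed
  finally show ?thesis
    using card_closed_neighborhood[OF G, of v] by simp
qed

section \<open>The two lower bounds\<close>

lemma degree_le_of_two_LP_partition:
  assumes G: "simple_graph V E" and P: "two_LP_partition V E P" and v: "v \<in> V"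
  shows "card (neighborhood E v) + 1 \<le> 2 * card P"
proof -
  have "(\<Sum>B\<in>P. card (B \<inter> closed_neighborhood E v)) \<le> (\<Sum>B\<in>P. 2)"
    using P v by (intro sum_mono) (auto simp: two_LP_partition_def two_limited_packing_def)
  then show ?thesis
    using degree_via_partition[OF G _ v, of P] P by (simp add: two_LP_partition_def)
qed

lemma size_le_of_two_LP_partition:
  assumes G: "simple_graph V E" and P: "two_LP_partition V E P"
  shows "2 * card E + card V \<le> 2 * card P * card V"
proof -
  have "2 * card E + card V = (\<Sum>v\<in>V. card (neighborhood E v) + 1)"
    by (simp add: sum.distrib handshake[OF G] del: One_nat_def)
  also have "\<dots> \<le> (\<Sum>v\<in>V. 2 * card P)"
    by (intro sum_mono degree_le_of_two_LP_partition[OF G P])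
  finally show ?thesis by (simp add: mult_ac)
qed

lemma finite_two_limited_packings:
  "finite V \<Longrightarrow> finite {B. two_limited_packing V E B}"
  by (rule finite_subset[of _ "Pow V"]) (auto simp: two_limited_packing_def)

lemma card_two_limited_packing_le:
  assumes "finite V" "two_limited_packing V E B"
  shows "card B \<le> two_limited_packing_number V E"
  unfolding two_limited_packing_number_def
  using assms finite_two_limited_packings[OF assms(1), of E] by (intro Max_ge) auto

lemma two_limited_packing_singleton:
  "v \<in> V \<Longrightarrow> two_limited_packing V E {v}"
  by (simp add: two_limited_packing_def Int_insert_left)

lemma two_limited_packing_number_pos:
  assumes "finite V" "V \<noteq> {}"
  shows "two_limited_packing_number V E > 0"
proof -
  obtain v where "v \<in> V" using assms by blast
  from card_two_limited_packing_le[OF assms(1) two_limited_packing_singleton[OF this], of E]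
  show ?thesis by simp
qed

lemma order_le_of_two_LP_partition:
  assumes "finite V" and P: "two_LP_partition V E P"
  shows "card V \<le> card P * two_limited_packing_number V E"
proof -
  have "card V \<le> (\<Sum>B\<in>P. card B)"
    using P card_Union_le_sum_card[of P] by (simp add: two_LP_partition_def partition_on_def)
  also have "\<dots> \<le> (\<Sum>B\<in>P. two_limited_packing_number V E)"
    using P assms(1) by (intro sum_mono card_two_limited_packing_le)
      (auto simp: two_LP_partition_def)
  finally show ?thesis by simp
qed

lemma finite_two_LP_partitions:
  assumes "finite V"
  shows "finite {P. two_LP_partition V E P}"
  by (rule finite_subset[OF _ finitely_many_partition_on[OF assms]])
    (auto simp: two_LP_partition_def)

lemma two_LP_partition_number_le:
  assumes "finite V" "two_LP_partition V E P"
  shows "two_LP_partition_number V E \<le> card P"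
  unfolding two_LP_partition_number_def
  using assms finite_two_LP_partitions[OF assms(1), of E] by (intro Min_le) auto

lemma two_LP_partition_number_attained:
  assumes "finite V"
  obtains P where "two_LP_partition V E P" "card P = two_LP_partition_number V E"
proof -
  have "partition_on V ((\<lambda>v. {v}) ` V)"
    by (rule partition_onI) auto
  then have "two_LP_partition V E ((\<lambda>v. {v}) ` V)"
    by (auto simp: two_LP_partition_def intro: two_limited_packing_singleton)
  then have "two_LP_partition_number V E \<in> card ` {P. two_LP_partition V E P}"
    unfolding two_LP_partition_number_def
    using finite_two_LP_partitions[OF assms, of E] by (intro Min_in) auto
  then show ?thesis using that by auto
qed

text \<open>
  Given \<open>n \<le> k l\<close>, the square-root bound is a consequence of the average-degree
  inequality, and whenever it is tight so is that inequality; hence equality is decided by the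
  average degree alone. The radicand may be negative; \<open>sqrt\<close> is then negative as well, so the
  inequality is unaffected and the square root cannot equal \<open>2 k - 1 \<ge> 1\<close>.
\<close>

lemma max_bound_of_size_and_order_bounds:
  fixes k n m l :: real
  assumes deg: "2 * m + n \<le> 2 * k * n" and cover: "n \<le> k * l"
    and "n > 0" "l > 0" "k \<ge> 1"
  shows "1 / 2 * (1 + max (2 * m / n) (sqrt (1 + (4 * m - 2 * n) / l))) \<le> k"
    and "k = 1 / 2 * (1 + max (2 * m / n) (sqrt (1 + (4 * m - 2 * n) / l)))
         \<longleftrightarrow> 2 * m + n = 2 * k * n"
proof -
  have avg: "2 * m / n \<le> 2 * k - 1"
    using deg \<open>n > 0\<close> by (simp add: field_simps)
  have avg_eq: "2 * m / n = 2 * k - 1 \<longleftrightarrow> 2 * m + n = 2 * k * n"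
    using \<open>n > 0\<close> by (auto simp: field_simps)
  have chain1: "4 * m - 2 * n \<le> 4 * (k - 1) * n"
    using deg by (simp add: algebra_simps)
  have chain2: "4 * (k - 1) * n \<le> 4 * (k - 1) * (k * l)"
    using cover \<open>k \<ge> 1\<close> by (intro mult_left_mono) auto
  have sq: "(2 * k - 1)\<^sup>2 = 1 + 4 * (k - 1) * (k * l) / l"
  proof -
    have "4 * (k - 1) * (k * l) / l = 4 * (k - 1) * k" using \<open>l > 0\<close> by simp
    then show ?thesis by (simp add: power2_eq_square algebra_simps)
  qed
  have "1 + (4 * m - 2 * n) / l \<le> (2 * k - 1)\<^sup>2"
    unfolding sq using divide_right_mono[OF order.trans[OF chain1 chain2], of l] \<open>l > 0\<close>
    by linarith
  then have root: "sqrt (1 + (4 * m - 2 * n) / l) \<le> 2 * k - 1"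
    using real_sqrt_le_mono[of _ "(2 * k - 1)\<^sup>2"] \<open>k \<ge> 1\<close> by fastforce
  \<comment> \<open>Tightness of the composite inequality forces tightness of its first link, \<open>chain1\<close>.\<close>
  have root_eq: "2 * m + n = 2 * k * n" if "sqrt (1 + (4 * m - 2 * n) / l) = 2 * k - 1"
  proof -
    have "1 + (4 * m - 2 * n) / l \<ge> 0"
      using that \<open>k \<ge> 1\<close> by (smt (verit) real_sqrt_lt_0_iff)
    then have "1 + (4 * m - 2 * n) / l = (2 * k - 1)\<^sup>2"
      using that by (metis real_sqrt_pow2)
    then have "4 * m - 2 * n = 4 * (k - 1) * (k * l)"
      unfolding sq using \<open>l > 0\<close> by (simp add: field_simps)
    then have "4 * m - 2 * n = 4 * (k - 1) * n"
      using chain1 chain2 by linarith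
    then show ?thesis by (simp add: algebra_simps)
  qed
  show "1 / 2 * (1 + max (2 * m / n) (sqrt (1 + (4 * m - 2 * n) / l))) \<le> k"
    using avg root by simp
  show "k = 1 / 2 * (1 + max (2 * m / n) (sqrt (1 + (4 * m - 2 * n) / l)))
         \<longleftrightarrow> 2 * m + n = 2 * k * n"
    using avg root avg_eq root_eq by (auto simp: max_def)
qed

section \<open>Exact partitions\<close>

definition exact_two_LP_partition :: "'a set \<Rightarrow> 'a set set \<Rightarrow> 'a set set \<Rightarrow> bool" where
  "exact_two_LP_partition V E P \<longleftrightarrow>
     partition_on V P \<and> (\<forall>B\<in>P. \<forall>v\<in>V. card (B \<inter> closed_neighborhood E v) = 2)"

lemma exact_imp_two_LP_partition:
  "exact_two_LP_partition V E P \<Longrightarrow> two_LP_partition V E P"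
  by (auto simp: exact_two_LP_partition_def two_LP_partition_def two_limited_packing_def
      partition_on_def)

lemma size_of_exact_partition:
  assumes G: "simple_graph V E" and P: "exact_two_LP_partition V E P"
  shows "2 * card E + card V = 2 * card P * card V"
proof -
  have "2 * card E + card V = (\<Sum>v\<in>V. card (neighborhood E v) + 1)"
    by (simp add: sum.distrib handshake[OF G] del: One_nat_def)
  also have "\<dots> = (\<Sum>v\<in>V. 2 * card P)"
  proof (rule sum.cong)
    fix v assume "v \<in> V"
    with P degree_via_partition[OF G _ this, of P]
    show "card (neighborhood E v) + 1 = 2 * card P"
      by (simp add: exact_two_LP_partition_def)
  qed simp
  finally show ?thesis by (simp add: mult_ac)
qed

text \<open>
  Both double sums of \<open>|B \<inter> N[v]|\<close> and of the constant \<open>2\<close>, taken over all \<open>v\<close> and \<open>B\<close>, have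
  the same value, while the summands of the former are at most those of the latter; so all
  of them agree.
\<close>

lemma exact_partition_of_size:
  assumes G: "simple_graph V E" and P: "two_LP_partition V E P"
    and size: "2 * card E + card V = 2 * card P * card V"
  shows "exact_two_LP_partition V E P"
proof -
  let ?c = "\<lambda>v B. card (B \<inter> closed_neighborhood E v)"
  have fV: "finite V" using G by (simp add: simple_graph_def)
  have part: "partition_on V P" using P by (simp add: two_LP_partition_def)
  have fP: "finite P" by (rule finite_elements[OF fV part])
  have le2: "?c v B \<le> 2" if "B \<in> P" "v \<in> V" for v B
    using P that by (auto simp: two_LP_partition_def two_limited_packing_def)
  have "(\<Sum>v\<in>V. \<Sum>B\<in>P. ?c v B) = (\<Sum>v\<in>V. card (neighborhood E v) + 1)"
    using degree_via_partition[OF G part] by simp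
  also have "\<dots> = (\<Sum>v\<in>V. \<Sum>B\<in>P. 2)"
    using size by (simp add: sum.distrib handshake[OF G] mult_ac del: One_nat_def)
  finally have total: "(\<Sum>v\<in>V. \<Sum>B\<in>P. ?c v B) = (\<Sum>v\<in>V. \<Sum>B\<in>P. 2)" .
  have row: "(\<Sum>B\<in>P. ?c v B) = (\<Sum>B\<in>P. 2)" if "v \<in> V" for v
  proof (rule sum_mono_inv[OF total _ that fV])
    show "(\<Sum>B\<in>P. ?c u B) \<le> (\<Sum>B\<in>P. 2)" if "u \<in> V" for u
      using le2 that by (intro sum_mono) auto
  qed
  have "?c v B = 2" if "B \<in> P" "v \<in> V" for v B
    using sum_mono_inv[OF row[OF that(2)] _ that(1) fP] le2 that(2) by simp
  with part show ?thesis by (simp add: exact_two_LP_partition_def)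
qed

section \<open>Exact partitions as members of the family\<close>

lemma perfect_matching_on_even_card:
  assumes "finite W" "perfect_matching_on W M"
  shows "even (card W)"
proof -
  have pairs: "M \<subseteq> [W]\<^bsup>2\<^esup>" and unique: "\<And>w. w \<in> W \<Longrightarrow> \<exists>!e. e \<in> M \<and> w \<in> e"
    using assms(2) by (auto simp: perfect_matching_on_def)
  have "\<Union>M = W"
    using pairs unique by (fastforce simp: nsets_def)
  have "2 dvd card (\<Union>M)"
  proof (rule dvd_partition)
    show "finite (\<Union>M)" using assms(1) \<open>\<Union>M = W\<close> by simp
    show "\<forall>e\<in>M. 2 dvd card e" using pairs by (auto simp: nsets_def)
    show "\<forall>e1\<in>M. \<forall>e2\<in>M. e1 \<noteq> e2 \<longrightarrow> e1 \<inter> e2 = {}"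
      using unique \<open>\<Union>M = W\<close> by blast
  qed
  then show ?thesis using \<open>\<Union>M = W\<close> by simp
qed

text \<open>
  This translates a matching, given through its edges, into neighbor counts, the
  language in which exact partitions are described.
\<close>

lemma perfect_matching_on_iff_partner:
  assumes M: "M \<subseteq> [W]\<^bsup>2\<^esup>"
  shows "perfect_matching_on W M \<longleftrightarrow> (\<forall>w\<in>W. card (neighborhood M w) = 1)"
proof -
  have "(\<exists>!e. e \<in> M \<and> w \<in> e) \<longleftrightarrow> card (neighborhood M w) = 1" for w
  proof -
    have e: "\<exists>u. e = {w, u}" if "e \<in> M" "w \<in> e" for e
    proof -
      have "card e = 2" using M that by (auto simp: nsets_def)
      with that show ?thesis by (auto simp: card_2_iff)
    qed
    show ?thesis
    proof
      assume "\<exists>!e. e \<in> M \<and> w \<in> e"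
      then obtain e' where e': "e' \<in> M" "w \<in> e'" "\<And>f. f \<in> M \<Longrightarrow> w \<in> f \<Longrightarrow> f = e'"
        by blast
      then obtain u where u: "e' = {w, u}" using e by blast
      have "x = u" if "{w, x} \<in> M" for x
        using e'(3)[OF that] u by (auto simp: doubleton_eq_iff)
      then have "neighborhood M w = {u}"
        using e'(1) u unfolding neighborhood_def by blast
      then show "card (neighborhood M w) = 1" by simp
    next
      assume "card (neighborhood M w) = 1"
      then obtain u where u: "neighborhood M w = {u}" by (auto simp: card_1_singleton_iff)
      show "\<exists>!e. e \<in> M \<and> w \<in> e"
      proof (rule ex1I)
        show "{w, u} \<in> M \<and> w \<in> {w, u}" using u by (auto simp: neighborhood_def)
        show "e' = {w, u}" if "e' \<in> M \<and> w \<in> e'" for e'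
          using e[of e'] that u by (auto simp: neighborhood_def)
      qed
    qed
  qed
  with M show ?thesis by (simp add: perfect_matching_on_def)
qed

lemma card_own_part:
  assumes G: "simple_graph V E" and "v \<in> B"
  shows "card (B \<inter> closed_neighborhood E v) = card (B \<inter> neighborhood E v) + 1"
proof -
  have "B \<inter> closed_neighborhood E v = insert v (B \<inter> neighborhood E v)"
    using assms(2) by (auto simp: closed_neighborhood_def)
  then show ?thesis
    using neighborhood_subset[OF G, of v] finite_neighborhood[OF G, of v]
    by (auto simp: card_insert_if)
qed

lemma other_part:
  "v \<notin> B \<Longrightarrow> B \<inter> closed_neighborhood E v = B \<inter> neighborhood E v"
  by (auto simp: closed_neighborhood_def)

text \<open>
  The parts become the partite sets, the edges inside a part its matching, and all other edges
  the multipartite graph. The vertex itself accounts for one of the two elements of \<open>N[v]\<close> in its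
  own part, leaving one neighbor there; in every other part both elements are neighbors.
\<close>

lemma exact_partition_imp_Lambda:
  assumes G: "simple_graph V E" and "V \<noteq> {}" and P: "exact_two_LP_partition V E P"
  shows "(V, E) \<in> Lambda"
proof -
  define r where "r = card P"
  have part: "partition_on V P"
    and two: "\<And>B v. B \<in> P \<Longrightarrow> v \<in> V \<Longrightarrow> card (B \<inter> closed_neighborhood E v) = 2"
    using P by (auto simp: exact_two_LP_partition_def)
  have fV: "finite V" using G by (simp add: simple_graph_def)
  have fP: "finite P" by (rule finite_elements[OF fV part])
  have "P \<noteq> {}" using part \<open>V \<noteq> {}\<close> by (auto simp: partition_on_def)
  then have r: "r \<ge> 1" using fP by (simp add: r_def Suc_le_eq card_gt_0_iff)
  obtain W where W: "bij_betw W {1..r} P"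
    using ex_bij_betw_nat_finite_1[OF fP] by (auto simp: r_def)
  have WP: "W i \<in> P" if "i \<in> {1..r}" for i
    using W that by (auto simp: bij_betw_def)
  have sub: "W i \<subseteq> V" if "i \<in> {1..r}" for i
    using WP[OF that] part by (auto simp: partition_on_def)
  have disj: "W i \<inter> W j = {}" if "i \<in> {1..r}" "j \<in> {1..r}" "i \<noteq> j" for i j
  proof -
    have "W i \<noteq> W j"
      using inj_onD[OF bij_betw_imp_inj_on[OF W]] that by blast
    then show ?thesis
      using disjointD[OF partition_onD2[OF part]] WP that by blast
  qed
  define F where "F = {e \<in> E. \<forall>i\<in>{1..r}. \<not> e \<subseteq> W i}"
  define M where "M i = {e \<in> E. e \<subseteq> W i}" for i
  have edge: "v \<noteq> u" "v \<in> V" "u \<in> V" if "{v, u} \<in> E" for v u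
    using simple_graph_edgeD[OF G that] by auto
  have "r_partite r W V F"
    unfolding r_partite_def
  proof (intro conjI ballI)
    show "simple_graph V F" using G by (auto simp: simple_graph_def F_def)
    show "(\<Union>i\<in>{1..r}. W i) = V"
      using W part by (simp add: bij_betw_def partition_on_def)
    show "disjoint_family_on W {1..r}" using disj by (auto simp: disjoint_family_on_def)
    show "W i \<noteq> {}" if "i \<in> {1..r}" for i
      using WP[OF that] part by (auto simp: partition_on_def)
    show "indep (W i) F" if "i \<in> {1..r}" for i
      using that by (auto simp: indep_def F_def)
  qed
  moreover have pm: "perfect_matching_on (W i) (M i)" if i: "i \<in> {1..r}" for i
  proof (subst perfect_matching_on_iff_partner)
    show "M i \<subseteq> [W i]\<^bsup>2\<^esup>"
      using G by (auto simp: M_def simple_graph_def nsets_def intro: finite_subset)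
    show "\<forall>w\<in>W i. card (neighborhood (M i) w) = 1"
    proof
      fix w assume w: "w \<in> W i"
      then have "neighborhood (M i) w = W i \<inter> neighborhood E w"
        by (auto simp: neighborhood_def M_def)
      then show "card (neighborhood (M i) w) = 1"
        using card_own_part[OF G w] two[OF WP[OF i], of w] sub[OF i] w by auto
    qed
  qed
  moreover have "even (card (W i))" if i: "i \<in> {1..r}" for i
    using perfect_matching_on_even_card[OF finite_subset[OF sub[OF i] fV] pm[OF i]] .
  moreover have "regular_graph 2 (W i \<union> W j) (induced_edges F (W i \<union> W j))"
    if i: "i \<in> {1..r}" and j: "j \<in> {1..r}" and ij: "i \<noteq> j" for i j
  proof -
    have half: "card (neighborhood (induced_edges F (W a \<union> W b)) v) = 2"
      if a: "a \<in> {1..r}" and b: "b \<in> {1..r}" and ab: "a \<noteq> b" and v: "v \<in> W a" for a b v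
    proof -
      have "v \<notin> W b" using disj[OF a b ab] v by blast
      have cross: "{v, u} \<in> F \<longleftrightarrow> {v, u} \<in> E" if u: "u \<in> W b" for u
      proof -
        have "\<not> {v, u} \<subseteq> W i" if "i \<in> {1..r}" for i
          using disj[OF that a] disj[OF a b ab] u v by (cases "i = a") auto
        then show ?thesis by (auto simp: F_def)
      qed
      have inner: "{v, u} \<notin> F" if "u \<in> W a" for u
        using that v a by (auto simp: F_def)
      have "neighborhood (induced_edges F (W a \<union> W b)) v = W b \<inter> neighborhood E v"
        using cross inner v by (auto simp: neighborhood_def induced_edges_def)
      then show ?thesis
        using other_part[OF \<open>v \<notin> W b\<close>, of E] two[OF WP[OF b], of v] sub[OF a] v by auto
    qed
    show ?thesis
      unfolding regular_graph_def
      using half[OF i j ij] half[OF j i ij[symmetric]] by (auto simp: Un_commute)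
  qed
  moreover have "E = F \<union> (\<Union>i\<in>{1..r}. M i)"
    by (auto simp: F_def M_def)
  ultimately show ?thesis
    unfolding Lambda_def using r by blast
qed

text \<open>
  The partite sets are independent in \<open>F\<close> and the matching edges stay inside them, so the edges
  of \<open>E\<close> inside a partite set are its matching edges and those between two partite sets come from
  \<open>F\<close>. The neighbors of \<open>v\<close> can thus be counted separately in each partite set.
\<close>

lemma Lambda_imp_exact_partition:
  assumes G: "simple_graph V E" and "(V, E) \<in> Lambda"
  obtains P where "exact_two_LP_partition V E P"
proof -
  obtain r W F M where shape: "r \<ge> 1 \<and> r_partite r W V F \<and>
     (\<forall>i\<in>{1..r}. even (card (W i))) \<and>
     (\<forall>i\<in>{1..r}. \<forall>j\<in>{1..r}. i \<noteq> j \<longrightarrow>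
        regular_graph 2 (W i \<union> W j) (induced_edges F (W i \<union> W j))) \<and>
     (\<forall>i\<in>{1..r}. perfect_matching_on (W i) (M i)) \<and>
     E = F \<union> (\<Union>i\<in>{1..r}. M i)"
    using assms(2) unfolding Lambda_def mem_Collect_eq prod.case by (elim exE)
  have rp: "r_partite r W V F" and E: "E = F \<union> (\<Union>i\<in>{1..r}. M i)"
    using shape by simp_all
  have reg: "regular_graph 2 (W i \<union> W j) (induced_edges F (W i \<union> W j))"
    if "i \<in> {1..r}" "j \<in> {1..r}" "i \<noteq> j" for i j
    using shape that by simp
  have pm: "perfect_matching_on (W i) (M i)" if "i \<in> {1..r}" for i
    using shape that by simp
  have V: "(\<Union>i\<in>{1..r}. W i) = V" and F: "simple_graph V F"
    using rp by (simp_all add: r_partite_def)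
  have disj: "W i \<inter> W j = {}" if "i \<in> {1..r}" "j \<in> {1..r}" "i \<noteq> j" for i j
    using rp that unfolding r_partite_def by (meson disjoint_family_onD)
  have ne: "W i \<noteq> {}" and ind: "indep (W i) F" if "i \<in> {1..r}" for i
    using rp that by (simp_all add: r_partite_def)
  have part: "partition_on V (W ` {1..r})"
  proof (rule partition_onI)
    show "\<Union> (W ` {1..r}) = V" by (rule V)
    show "disjnt A B" if AB: "A \<in> W ` {1..r}" "B \<in> W ` {1..r}" "A \<noteq> B" for A B
    proof -
      obtain i j where "i \<in> {1..r}" "j \<in> {1..r}" "A = W i" "B = W j" using AB by blast
      with AB(3) disj[of i j] show ?thesis unfolding disjnt_def by blast
    qed
    show "{} \<notin> W ` {1..r}" using ne by blast
  qed
  have indep_F: "{v, u} \<notin> F" if "i \<in> {1..r}" "v \<in> W i" "u \<in> W i" for i u v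
    using ind[OF that(1)] that(2,3) simple_graph_edgeD(3)[OF F, of v u]
    unfolding indep_def by blast
  have M_sub: "M i \<subseteq> [W i]\<^bsup>2\<^esup>" if "i \<in> {1..r}" for i
    using pm[OF that] by (simp add: perfect_matching_on_def)
  have M_in: "v \<in> W i" "u \<in> W i" if "i \<in> {1..r}" "{v, u} \<in> M i" for i u v
    using subsetD[OF M_sub[OF that(1)] that(2)] by simp_all
  have "card (W i \<inter> closed_neighborhood E v) = 2" if i: "i \<in> {1..r}" and "v \<in> V" for i v
  proof -
    obtain j where j: "j \<in> {1..r}" and v: "v \<in> W j" using \<open>v \<in> V\<close> V by blast
    show ?thesis
    proof (cases "j = i")
      case True
      with v have v: "v \<in> W i" by simp
      have "{v, u} \<in> E \<longleftrightarrow> {v, u} \<in> M i" if u: "u \<in> W i" for u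
        using indep_F[OF i v u] M_in disj i v E by blast
      then have "W i \<inter> neighborhood E v = neighborhood (M i) v"
        using M_in[OF i] by (auto simp: neighborhood_def)
      moreover have "card (neighborhood (M i) v) = 1"
        using perfect_matching_on_iff_partner[OF M_sub[OF i]] pm[OF i] v by blast
      ultimately show ?thesis
        using card_own_part[OF G v] by simp
    next
      case False
      have "v \<notin> W i" using disj[OF i j] False v by blast
      have "{v, u} \<in> E \<longleftrightarrow> {v, u} \<in> F" if u: "u \<in> W i" for u
        using M_in disj i j v u False E by blast
      then have "W i \<inter> neighborhood E v
          = neighborhood (induced_edges F (W j \<union> W i)) v"
        using indep_F[OF j v] v by (auto simp: neighborhood_def induced_edges_def)
      moreover have "card (neighborhood (induced_edges F (W j \<union> W i)) v) = 2"
        using reg[OF j i False] v by (auto simp: regular_graph_def)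
      ultimately show ?thesis
        using other_part[OF \<open>v \<notin> W i\<close>, of E] by simp
    qed
  qed
  with part have "exact_two_LP_partition V E (W ` {1..r})"
    by (simp add: exact_two_LP_partition_def)
  then show ?thesis by (rule that)
qed

section \<open>The bound and its equality case\<close>

theorem theorem3p2:
  fixes V :: "'a set" and E :: "'a set set" and n m :: nat
  assumes "simple_graph V E" and "V \<noteq> {}"
    and "n = card V" and "m = card E"
  shows "real (two_LP_partition_number V E) \<ge>
           1 / 2 * (1 + max (2 * real m / real n)
             (sqrt (1 + (4 * real m - 2 * real n) / real (two_limited_packing_number V E))))
       \<and> (real (two_LP_partition_number V E) =
           1 / 2 * (1 + max (2 * real m / real n)
             (sqrt (1 + (4 * real m - 2 * real n) / real (two_limited_packing_number V E))))
          \<longleftrightarrow> (V, E) \<in> Lambda)"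
proof -
  note G = assms(1)
  let ?k = "two_LP_partition_number V E" and ?l = "two_limited_packing_number V E"
  have fV: "finite V" using G by (simp add: simple_graph_def)
  have n: "n > 0" using assms fV by (simp add: card_gt_0_iff)
  obtain P where P: "two_LP_partition V E P" and k: "card P = ?k"
    by (rule two_LP_partition_number_attained[OF fV])
  have deg: "2 * m + n \<le> 2 * ?k * n"
    using size_le_of_two_LP_partition[OF G P] assms k by simp
  have cover: "n \<le> ?k * ?l"
    using order_le_of_two_LP_partition[OF fV P] assms k by simp
  have "?k \<ge> 1" using cover n by (cases ?k) auto
  have l: "?l > 0" by (rule two_limited_packing_number_pos[OF fV \<open>V \<noteq> {}\<close>])
  have deg': "2 * real m + real n \<le> 2 * real ?k * real n"
    using of_nat_mono[OF deg, where 'a = real] by simp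
  have cover': "real n \<le> real ?k * real ?l"
    using of_nat_mono[OF cover, where 'a = real] by simp
  have tight: "2 * real m + real n = 2 * real ?k * real n \<longleftrightarrow> 2 * m + n = 2 * ?k * n"
    using of_nat_eq_iff[of "2 * m + n" "2 * ?k * n", where 'a = real] by simp
  have "2 * m + n = 2 * ?k * n \<longleftrightarrow> (V, E) \<in> Lambda"
  proof
    assume "2 * m + n = 2 * ?k * n"
    then have "exact_two_LP_partition V E P"
      using exact_partition_of_size[OF G P] assms k by simp
    then show "(V, E) \<in> Lambda"
      by (rule exact_partition_imp_Lambda[OF G \<open>V \<noteq> {}\<close>])
  next
    assume "(V, E) \<in> Lambda"
    then obtain Q where Q: "exact_two_LP_partition V E Q"
      by (rule Lambda_imp_exact_partition[OF G])
    have "?k \<le> card Q"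
      by (rule two_LP_partition_number_le[OF fV exact_imp_two_LP_partition[OF Q]])
    moreover have size: "2 * m + n = 2 * card Q * n"
      using size_of_exact_partition[OF G Q] assms by simp
    moreover have "card Q \<le> ?k" using size deg n by simp
    ultimately show "2 * m + n = 2 * ?k * n" by simp
  qed
  then show ?thesis
    using max_bound_of_size_and_order_bounds[OF deg' cover'] n l \<open>?k \<ge> 1\<close> tight by simp
qed

end
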